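(* Let $f$ be Riemann-integrable on the interval $[a,b]$ such that $f$ is continuous from the left at every integer $n$ with $a<n\le b$. Then $$\sum_{a<n\le b}f(n)=\int_a^b f(u)\,du+\int_a^b\Big(u-[u]-\frac12\Big)df(u)+f(a)\Big(a-[a]-\frac12\Big)-f(b)\Big(b-[b]-\frac12\Big).$$
   Context: $[x]$ denotes the integral part of the real number $x$; the sum runs over integers $n$. The integral with respect to $df$ is a Riemann–Stieltjes integral. *)

theory Defs
  imports "HOL-Analysis.Analysis"
begin

hide_const (open) Polynomial.content

text \<open>
  Riemann integrability is stated with the tagged divisions of the library, but with a uniform
  bound on the mesh instead of an arbitrary gauge. By \<open>has_riemann_integral_imp_has_integral\<close>
  the value of the Riemann integral is the library's \<^term>\<open>integral {a..b} f\<close>.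
\<close>

definition has_riemann_integral :: "(real \<Rightarrow> real) \<Rightarrow> real \<Rightarrow> real \<Rightarrow> real \<Rightarrow> bool" where
  "has_riemann_integral f I a b \<longleftrightarrow>
     (\<forall>e>0. \<exists>d>0. \<forall>p. p tagged_division_of {a..b} \<and> (\<forall>(x, K)\<in>p. content K < d) \<longrightarrow>
        \<bar>(\<Sum>(x, K)\<in>p. content K * f x) - I\<bar> < e)"

definition riemann_integrable :: "(real \<Rightarrow> real) \<Rightarrow> real \<Rightarrow> real \<Rightarrow> bool" where
  "riemann_integrable f a b \<longleftrightarrow> (\<exists>I. has_riemann_integral f I a b)"

text \<open>
  The Riemann--Stieltjes integral of \<open>g\<close> with respect to \<open>df\<close> is the limit of the sums
  of \<open>g(x) (f(v) - f(u))\<close>, for cells \<open>[u, v]\<close> with tag \<open>x\<close>, along refinement of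
  divisions (the Pollard--Moore integral); a tagged division refines \<open>D\<close> if each of its cells
  lies in a cell of \<open>D\<close>. The limit as the mesh tends to 0 would be too restrictive: it need
  not exist if \<open>f\<close> and \<open>g\<close> jump at the same point, even from opposite sides.
\<close>

definition has_rs_integral ::
    "(real \<Rightarrow> real) \<Rightarrow> (real \<Rightarrow> real) \<Rightarrow> real \<Rightarrow> real \<Rightarrow> real \<Rightarrow> bool" where
  "has_rs_integral g f I a b \<longleftrightarrow>
     (\<forall>e>0. \<exists>D. D division_of {a..b} \<and>
        (\<forall>p. p tagged_division_of {a..b} \<and> (\<forall>(x, K)\<in>p. \<exists>K'\<in>D. K \<subseteq> K') \<longrightarrow>
           \<bar>(\<Sum>(x, K)\<in>p. g x * (f (Sup K) - f (Inf K))) - I\<bar> < e))"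

definition rs_integrable :: "(real \<Rightarrow> real) \<Rightarrow> (real \<Rightarrow> real) \<Rightarrow> real \<Rightarrow> real \<Rightarrow> bool" where
  "rs_integrable g f a b \<longleftrightarrow> (\<exists>I. has_rs_integral g f I a b)"

definition rs_integral :: "(real \<Rightarrow> real) \<Rightarrow> (real \<Rightarrow> real) \<Rightarrow> real \<Rightarrow> real \<Rightarrow> real" where
  "rs_integral g f a b = (THE I. has_rs_integral g f I a b)"

lemma has_riemann_integral_imp_has_integral:
  assumes "has_riemann_integral f I a b"
  shows "(f has_integral I) {a..b}"
  unfolding has_integral_real
proof (intro allI impI)
  fix e :: real assume "e > 0"
  then obtain d where d: "d > 0"
    and *: "\<And>p. p tagged_division_of {a..b} \<Longrightarrow> (\<forall>(x, K)\<in>p. content K < d) \<Longrightarrow>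
        \<bar>(\<Sum>(x, K)\<in>p. content K * f x) - I\<bar> < e"
    using assms unfolding has_riemann_integral_def by meson
  have "norm ((\<Sum>(x, K)\<in>p. content K *\<^sub>R f x) - I) < e"
    if p: "p tagged_division_of {a..b}" and fine: "(\<lambda>x. ball x (d / 2)) fine p" for p
  proof -
    have "content K < d" if xK: "(x, K) \<in> p" for x K
    proof -
      obtain u v where K: "K = {u..v}" and "x \<in> K"
        using p xK by (metis box_real(2) tagged_division_ofD(2,4))
      then have "u \<in> K" "v \<in> K" "u \<le> v" by auto
      moreover have "K \<subseteq> ball x (d / 2)" using fine xK by (auto simp: fine_def)
      ultimately have "dist x u < d / 2" "dist x v < d / 2" by auto
      then have "\<bar>x - u\<bar> < d / 2" "\<bar>x - v\<bar> < d / 2" by (simp_all add: dist_real_def)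
      then have "v - u < d" by linarith
      then show ?thesis using K \<open>u \<le> v\<close> by simp
    qed
    then show ?thesis using *[OF p] by auto
  qed
  then show "\<exists>\<gamma>. gauge \<gamma> \<and> (\<forall>p. p tagged_division_of {a..b} \<and> \<gamma> fine p \<longrightarrow>
      norm ((\<Sum>(x, K)\<in>p. content K *\<^sub>R f x) - I) < e)"
    using d by (intro exI[of _ "\<lambda>x. ball x (d / 2)"]) auto
qed

lemma division_imp_tagged_division:
  fixes D :: "real set set"
  assumes "D division_of S"
  shows "(\<lambda>K. (Inf K, K)) ` D tagged_division_of S" (is "?p tagged_division_of S")
proof (rule tagged_division_ofI)
  note * = division_ofD[OF assms]
  show "finite ?p" using *(1) by simp
  fix x K assume "(x, K) \<in> ?p"
  then have K: "K \<in> D" "x = Inf K" by auto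
  obtain u v where uv: "K = cbox u v" using *(4)[OF K(1)] by blast
  then show "\<exists>u v. K = cbox u v" by blast
  show "x \<in> K" using uv *(3)[OF K(1)] K(2) by (simp add: box_real)
  show "K \<subseteq> S" by (rule *(2)[OF K(1)])
next
  fix x1 K1 x2 K2 assume "(x1, K1) \<in> ?p" "(x2, K2) \<in> ?p" "(x1, K1) \<noteq> (x2, K2)"
  then have "K1 \<in> D" "K2 \<in> D" "K1 \<noteq> K2" by auto
  then show "interior K1 \<inter> interior K2 = {}" by (rule division_ofD(5)[OF assms])
next
  have "{K. \<exists>x. (x, K) \<in> ?p} = D" by auto
  then show "\<Union>{K. \<exists>x. (x, K) \<in> ?p} = S" using division_ofD(6)[OF assms] by simp
qed

lemma has_rs_integral_unique:
  assumes I: "has_rs_integral g f I a b" and J: "has_rs_integral g f J a b"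
  shows "I = J"
proof (rule ccontr)
  assume "I \<noteq> J"
  define e where "e = \<bar>I - J\<bar> / 2"
  have e: "e > 0" using \<open>I \<noteq> J\<close> by (simp add: e_def)
  let ?S = "\<lambda>p. \<Sum>(x, K)\<in>p. g x * (f (Sup K) - f (Inf K))"
  from I e obtain D1 where D1: "D1 division_of {a..b}"
    and 1: "\<And>p. p tagged_division_of {a..b} \<Longrightarrow> (\<forall>(x, K)\<in>p. \<exists>K'\<in>D1. K \<subseteq> K') \<Longrightarrow> \<bar>?S p - I\<bar> < e"
    unfolding has_rs_integral_def by meson
  from J e obtain D2 where D2: "D2 division_of {a..b}"
    and 2: "\<And>p. p tagged_division_of {a..b} \<Longrightarrow> (\<forall>(x, K)\<in>p. \<exists>K'\<in>D2. K \<subseteq> K') \<Longrightarrow> \<bar>?S p - J\<bar> < e"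
    unfolding has_rs_integral_def by meson
  define D where "D = {k1 \<inter> k2 | k1 k2. k1 \<in> D1 \<and> k2 \<in> D2 \<and> k1 \<inter> k2 \<noteq> {}}"
  define p where "p = (\<lambda>K. (Inf K, K)) ` D"
  have "p tagged_division_of {a..b}"
    unfolding p_def using division_inter[OF D1 D2]
    by (intro division_imp_tagged_division) (simp add: D_def)
  moreover have "\<forall>(x, K)\<in>p. \<exists>K'\<in>D1. K \<subseteq> K'" "\<forall>(x, K)\<in>p. \<exists>K'\<in>D2. K \<subseteq> K'"
    unfolding p_def D_def by auto
  ultimately have "\<bar>?S p - I\<bar> < e" "\<bar>?S p - J\<bar> < e" using 1 2 by auto
  then show False unfolding e_def by (auto simp: abs_if split: if_splits)
qed

lemma has_rs_integral_imp_eq: "has_rs_integral g f I a b \<Longrightarrow> rs_integral g f a b = I"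
  unfolding rs_integral_def by (blast intro: has_rs_integral_unique)

end

theory Submission
  imports Defs
begin

text \<open>
  Put \<open>g(u) = u - [u] - 1/2\<close>. For a cell \<open>[u, v]\<close> with tag \<open>x\<close>,
  \<open>g(x) (f(v) - f(u)) = f(v) g(v) - f(u) g(u) - (f(u) (x - u) + f(v) (v - x))
  + (f(u) ([x] - [u]) + f(v) ([v] - [x]))\<close>.
  Summed over a tagged division, the first difference telescopes and the second bracket is a
  Riemann sum of \<open>f\<close> for the cells \<open>[u, x]\<close>, \<open>[x, v]\<close> with tags \<open>u\<close>, \<open>v\<close>. If no integer lies
  inside \<open>(u, v)\<close>, the last bracket vanishes unless \<open>v\<close> is an integer, when it is \<open>f(v)\<close> for
  \<open>x < v\<close> and \<open>f(u)\<close> for \<open>x = v\<close>; by left continuity it is then close to \<open>f(v)\<close> either way.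
\<close>

section \<open>Cells of tagged divisions and summation by parts\<close>

lemma tagged_division_of_real_cell:
  fixes a b :: real
  assumes "p tagged_division_of {a..b}" "(x, K) \<in> p"
  obtains u v where "K = {u..v}" "a \<le> u" "u \<le> x" "x \<le> v" "v \<le> b"
proof -
  obtain u v where uv: "K = cbox u v" using tagged_division_ofD(4)[OF assms] by blast
  moreover have "x \<in> K" "K \<subseteq> {a..b}" using tagged_division_ofD(2,3)[OF assms] by auto
  ultimately show thesis using that[of u v] by auto
qed

text \<open>Discrete integration by parts: the increments of \<open>f * g\<close> telescope over the
  cells. What remains is a Stieltjes sum of \<open>f\<close> against \<open>g\<close> over the cells
  cut at their tags, with \<open>f\<close> evaluated only at end points of the original
  cells.\<close>

lemma rs_sum_by_parts:
  fixes f g :: "real \<Rightarrow> real"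
  assumes "a \<le> b" "p tagged_division_of {a..b}"
  shows "(\<Sum>(x, K)\<in>p. g x * (f (Sup K) - f (Inf K))) = f b * g b - f a * g a
    - (\<Sum>(x, K)\<in>p. f (Inf K) * (g x - g (Inf K)) + f (Sup K) * (g (Sup K) - g x))"
proof -
  have "f b * g b - f a * g a =
      (\<Sum>(x, K)\<in>p. f (Sup K) * g (Sup K) - f (Inf K) * g (Inf K))"
    using additive_tagged_division_1[OF assms, of "\<lambda>t. f t * g t"] by simp
  then show ?thesis
    by (simp add: sum_subtractf[symmetric] split_def algebra_simps)
qed

section \<open>Cutting each cell at its tag\<close>

text \<open>The roles of tags and end points are exchanged, as integration by parts demands. A half
  is a single point when the tag is an end point of its cell, and such halves of different cells may
  coincide as pairs.\<close>

definition split_at_tags :: "(real \<times> real set) set \<Rightarrow> (real \<times> real set) set" where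
  "split_at_tags p =
     (\<lambda>(x, K). (Inf K, {Inf K..x})) ` p \<union> (\<lambda>(x, K). (Sup K, {x..Sup K})) ` p"

lemma split_at_tags_cases:
  fixes a b :: real
  assumes "p tagged_division_of {a..b}" "(y, L) \<in> split_at_tags p"
  obtains x u v where "(x, {u..v}) \<in> p" "a \<le> u" "u \<le> x" "x \<le> v" "v \<le> b"
    "y = u \<and> L = {u..x} \<or> y = v \<and> L = {x..v}"
proof -
  obtain x K where xK: "(x, K) \<in> p"
    and yL: "(y, L) = (Inf K, {Inf K..x}) \<or> (y, L) = (Sup K, {x..Sup K})"
    using assms(2) unfolding split_at_tags_def by auto
  obtain u v where "K = {u..v}" "a \<le> u" "u \<le> x" "x \<le> v" "v \<le> b"
    using tagged_division_of_real_cell[OF assms(1) xK] .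
  then show thesis using xK yL by (intro that[of x u v]) auto
qed

text \<open>Disjointness of interiors is required of distinct pairs of tag and cell, so a common
  interior point identifies the tags too. It also makes the interval nonempty, so that its end
  points can be read off from the set.\<close>

lemma tagged_division_of_overlap:
  fixes a b :: real
  assumes "p tagged_division_of {a..b}" "(x, {u..v}) \<in> p" "(x', {u'..v'}) \<in> p"
    and "t \<in> {u<..<v}" "t \<in> {u'<..<v'}"
  shows "x = x' \<and> u = u' \<and> v = v'"
proof -
  have "(x, {u..v}) = (x', {u'..v'})"
    using tagged_division_ofD(5)[OF assms(1-3)] assms(4,5)
    unfolding interior_atLeastAtMost_real by blast
  then show ?thesis using assms(4) by auto
qed

text \<open>Halves with overlapping interiors come from the same cell by
  \<open>tagged_division_of_overlap\<close>, and the two halves of one cell meet only at its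
  tag.\<close>

lemma split_at_tags_tagged_division:
  fixes a b :: real
  assumes p: "p tagged_division_of {a..b}"
  shows "split_at_tags p tagged_division_of {a..b}"
proof (rule tagged_division_ofI)
  show "finite (split_at_tags p)"
    using tagged_division_ofD(1)[OF p] by (simp add: split_at_tags_def)
next
  fix y L assume yL: "(y, L) \<in> split_at_tags p"
  obtain x u v where c: "a \<le> u" "u \<le> x" "x \<le> v" "v \<le> b"
    "y = u \<and> L = {u..x} \<or> y = v \<and> L = {x..v}"
    using split_at_tags_cases[OF p yL] by metis
  show "y \<in> L" "L \<subseteq> {a..b}" using c by auto
  show "\<exists>u v. L = cbox u v" using c(5) by auto
next
  fix y L y' L' assume yL: "(y, L) \<in> split_at_tags p" and yL': "(y', L') \<in> split_at_tags p"
    and ne: "(y, L) \<noteq> (y', L')"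
  obtain x u v where c: "(x, {u..v}) \<in> p" "u \<le> x" "x \<le> v"
    "y = u \<and> L = {u..x} \<or> y = v \<and> L = {x..v}"
    using split_at_tags_cases[OF p yL] by metis
  obtain x' u' v' where c': "(x', {u'..v'}) \<in> p" "u' \<le> x'" "x' \<le> v'"
    "y' = u' \<and> L' = {u'..x'} \<or> y' = v' \<and> L' = {x'..v'}"
    using split_at_tags_cases[OF p yL'] by metis
  show "interior L \<inter> interior L' = {}"
  proof (rule ccontr)
    assume "interior L \<inter> interior L' \<noteq> {}"
    then obtain t where t: "t \<in> interior L" "t \<in> interior L'" by blast
    then have "t \<in> {u<..<v}" "t \<in> {u'<..<v'}" using c c' by auto
    then have "x = x'" "u = u'" "v = v'"
      using tagged_division_of_overlap[OF p c(1) c'(1)] by blast+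
    then show False using c c' t ne by auto
  qed
next
  show "\<Union>{L. \<exists>y. (y, L) \<in> split_at_tags p} = {a..b}" (is "?U = _")
  proof (intro equalityI subsetI)
    fix t assume "t \<in> ?U"
    then obtain y L where yL: "(y, L) \<in> split_at_tags p" and "t \<in> L" by blast
    obtain x u v where "a \<le> u" "u \<le> x" "x \<le> v" "v \<le> b"
      "y = u \<and> L = {u..x} \<or> y = v \<and> L = {x..v}"
      using split_at_tags_cases[OF p yL] by metis
    then show "t \<in> {a..b}" using \<open>t \<in> L\<close> by auto
  next
    fix t assume "t \<in> {a..b}"
    then obtain x K where xK: "(x, K) \<in> p" and t: "t \<in> K"
      using tagged_division_ofD(6)[OF p] by blast
    obtain u v where K: "K = {u..v}" "u \<le> x" "x \<le> v"
      using tagged_division_of_real_cell[OF p xK] by metis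
    have "(Inf K, {Inf K..x}) \<in> split_at_tags p" "(Sup K, {x..Sup K}) \<in> split_at_tags p"
      using xK unfolding split_at_tags_def by force+
    moreover have "t \<in> {Inf K..x} \<or> t \<in> {x..Sup K}" using t K by auto
    ultimately show "t \<in> ?U" by blast
  qed
qed

text \<open>As \<open>split_at_tags p\<close> is a set, equal halves are counted once on the left
  but several times on the right. This is harmless because halves that coincide have content
  0.\<close>

lemma sum_split_at_tags:
  fixes f :: "real \<Rightarrow> real" and a b :: real
  assumes p: "p tagged_division_of {a..b}"
  shows "(\<Sum>(y, L)\<in>split_at_tags p. content L * f y) =
    (\<Sum>(x, K)\<in>p. f (Inf K) * (x - Inf K) + f (Sup K) * (Sup K - x))"
proof -
  let ?h = "\<lambda>(y, L). content L * f y"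
  let ?l = "\<lambda>(x, K). (Inf K, {Inf K..x})" and ?r = "\<lambda>(x, K). (Sup K, {x..Sup K})"
  have fin: "finite p" using tagged_division_ofD(1)[OF p] .
  have nontriv_l: "?h (?l s) = 0" if s: "s \<in> p" "s' \<in> p" "s \<noteq> s'" "?l s = ?l s'" for s s'
  proof -
    obtain x K where x: "s = (x, K)" by (rule prod.exhaust)
    obtain x' K' where x': "s' = (x', K')" by (rule prod.exhaust)
    note xK = x x'
    obtain u v where K: "K = {u..v}" "u \<le> x" "x \<le> v"
      using tagged_division_of_real_cell[OF p] s(1) xK by metis
    obtain u' v' where K': "K' = {u'..v'}" "u' \<le> x'" "x' \<le> v'"
      using tagged_division_of_real_cell[OF p] s(2) xK by metis
    \<comment> \<open>If the common left half were nondegenerate, its midpoint would be interior to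
      both cells, forcing \<open>s = s'\<close>.\<close>
    have eq: "u' = u" "x' = x" using s(4) xK K K' by auto
    have "x = u"
    proof (rule ccontr)
      assume "x \<noteq> u"
      then have "(u + x) / 2 \<in> {u<..<v}" "(u + x) / 2 \<in> {u'<..<v'}"
        using K K' eq by auto
      then have "x = x' \<and> u = u' \<and> v = v'"
        using tagged_division_of_overlap[OF p] s(1,2) xK K(1) K'(1) by blast
      then show False using s(3) xK K(1) K'(1) by simp
    qed
    then show ?thesis using xK K by simp
  qed
  have nontriv_r: "?h (?r s) = 0" if s: "s \<in> p" "s' \<in> p" "s \<noteq> s'" "?r s = ?r s'" for s s'
  proof -
    obtain x K where x: "s = (x, K)" by (rule prod.exhaust)
    obtain x' K' where x': "s' = (x', K')" by (rule prod.exhaust)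
    note xK = x x'
    obtain u v where K: "K = {u..v}" "u \<le> x" "x \<le> v"
      using tagged_division_of_real_cell[OF p] s(1) xK by metis
    obtain u' v' where K': "K' = {u'..v'}" "u' \<le> x'" "x' \<le> v'"
      using tagged_division_of_real_cell[OF p] s(2) xK by metis
    have eq: "v' = v" "x' = x" using s(4) xK K K' by auto
    have "x = v"
    proof (rule ccontr)
      assume "x \<noteq> v"
      then have "(x + v) / 2 \<in> {u<..<v}" "(x + v) / 2 \<in> {u'<..<v'}"
        using K K' eq by auto
      then have "x = x' \<and> u = u' \<and> v = v'"
        using tagged_division_of_overlap[OF p] s(1,2) xK K(1) K'(1) by blast
      then show False using s(3) xK K(1) K'(1) by simp
    qed
    then show ?thesis using xK K by simp
  qed
  \<comment> \<open>A pair of both kinds has its tag at the left end and at the right end of its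
    interval, which is therefore a point.\<close>
  have common: "?h z = 0" if z: "z \<in> ?l ` p \<inter> ?r ` p" for z
  proof -
    obtain s s' where "s \<in> p" "z = ?l s" "s' \<in> p" "z = ?r s'" using z by blast
    moreover obtain x K where "s = (x, K)" by (rule prod.exhaust)
    moreover obtain x' K' where "s' = (x', K')" by (rule prod.exhaust)
    ultimately have xK: "(x, K) \<in> p" "z = (Inf K, {Inf K..x})"
      and xK': "(x', K') \<in> p" "z = (Sup K', {x'..Sup K'})" by auto
    obtain u v where K: "K = {u..v}" "u \<le> x" "x \<le> v"
      using tagged_division_of_real_cell[OF p xK(1)] by metis
    obtain u' v' where K': "K' = {u'..v'}" "u' \<le> x'" "x' \<le> v'"
      using tagged_division_of_real_cell[OF p xK'(1)] by metis
    have "u = x" using xK(2) xK'(2) K K' by auto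
    then show ?thesis using xK(2) K by simp
  qed
  have cell: "?h (?l s) + ?h (?r s) =
      (case s of (x, K) \<Rightarrow> f (Inf K) * (x - Inf K) + f (Sup K) * (Sup K - x))"
    if "s \<in> p" for s
  proof -
    obtain x K where xK: "s = (x, K)" by (rule prod.exhaust)
    have "(x, K) \<in> p" using that xK by simp
    then obtain u v where "K = {u..v}" "u \<le> x" "x \<le> v"
      using tagged_division_of_real_cell[OF p] by metis
    then show ?thesis using xK by simp
  qed
  have "sum ?h (split_at_tags p) = sum ?h (?l ` p) + sum ?h (?r ` p)"
    unfolding split_at_tags_def using fin common by (intro sum.union_inter_neutral) auto
  also have "\<dots> = sum (?h \<circ> ?l) p + sum (?h \<circ> ?r) p"
    using sum.reindex_nontrivial[OF fin, of ?l ?h] sum.reindex_nontrivial[OF fin, of ?r ?h]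
      nontriv_l nontriv_r by presburger
  also have "\<dots> = (\<Sum>s\<in>p. ?h (?l s) + ?h (?r s))" by (simp add: sum.distrib)
  also have "\<dots> = (\<Sum>(x, K)\<in>p. f (Inf K) * (x - Inf K) + f (Sup K) * (Sup K - x))"
    by (rule sum.cong[OF refl cell])
  finally show ?thesis .
qed

section \<open>Fine divisions with no integer inside a cell\<close>

text \<open>The grid of multiples of \<open>1 / N\<close> is cut down to the interval. Every integer
  is a grid point, so none lies inside a grid cell; this and the length bound pass to subintervals,
  hence to all refinements.\<close>

lemma fine_division_at_integers:
  fixes a b d :: real
  assumes "a \<le> b" "0 < d"
  obtains D where "D division_of {a..b}"
    and "\<And>u v K'. u \<le> v \<Longrightarrow> {u..v} \<subseteq> K' \<Longrightarrow> K' \<in> D \<Longrightarrow>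
      v - u < d \<and> (\<forall>n::int. \<not> (u < n \<and> n < v))"
proof -
  obtain N0 :: nat where N0: "inverse (real (Suc N0)) < d"
    using reals_Archimedean[OF assms(2)] by blast
  define N where "N = int (Suc N0)"
  have N: "N > 0" "1 / of_int N < d" using N0 by (simp_all add: N_def inverse_eq_divide)
  define c where "c = (\<lambda>k::int. {max a (k / N)..min b ((k + 1) / N)})"
  define A where "A = {\<lfloor>a * N\<rfloor>..\<lfloor>b * N\<rfloor>}"
  \<comment> \<open>The index range admits only grid cells that meet the interval, possibly in a
    single point at an end.\<close>
  have ne: "max a (k / N) \<le> min b ((k + 1) / N)" if "k \<in> A" for k
  proof -
    have "a * N \<le> k + 1" "k \<le> b * N" using that unfolding A_def by (auto, linarith+)
    then have "a \<le> (k + 1) / N" "k / N \<le> b" using N by (simp_all add: field_simps)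
    then show ?thesis using assms(1) N by (simp add: divide_right_mono)
  qed
  have disj: "interior (c k) \<inter> interior (c l) = {}" if "k < l" for k l
  proof -
    have "(k + 1) / N \<le> l / N" using that N by (intro divide_right_mono) auto
    then show ?thesis by (auto simp: c_def)
  qed
  have "c ` A division_of {a..b}"
  proof (rule division_ofI)
    show "finite (c ` A)" by (simp add: A_def)
  next
    fix K assume "K \<in> c ` A"
    then obtain k where k: "k \<in> A" "K = c k" by blast
    show "K \<subseteq> {a..b}" using k by (auto simp: c_def)
    show "K \<noteq> {}" using k ne[OF k(1)] by (auto simp: c_def)
    show "\<exists>u v. K = cbox u v" using k by (auto simp: c_def)
  next
    fix K L assume "K \<in> c ` A" "L \<in> c ` A" "K \<noteq> L"
    then obtain k l where "K = c k" "L = c l" "k \<noteq> l" by blast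
    then show "interior K \<inter> interior L = {}" using disj[of k l] disj[of l k] by fastforce
  next
    show "\<Union> (c ` A) = {a..b}"
    proof (intro equalityI subsetI)
      fix t assume "t \<in> {a..b}"
      define k where "k = \<lfloor>t * N\<rfloor>"
      have "k \<in> A" using \<open>t \<in> {a..b}\<close> N unfolding A_def k_def
        by (auto intro!: floor_mono mult_right_mono)
      moreover have "k \<le> t * N" "t * N \<le> k + 1" unfolding k_def by linarith+
      then have "t \<in> c k" using \<open>t \<in> {a..b}\<close> N by (auto simp: c_def field_simps)
      ultimately show "t \<in> \<Union> (c ` A)" by blast
    qed (auto simp: c_def)
  qed
  then show thesis
  proof (rule that)
    fix u v K' assume uv: "u \<le> v" "{u..v} \<subseteq> K'" and "K' \<in> c ` A"
    then obtain k where "K' = c k" by blast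
    then have "u \<in> c k" "v \<in> c k" using uv by auto
    then have k: "k / N \<le> u" "v \<le> (k + 1) / N" by (auto simp: c_def)
    then have "v - u \<le> (k + 1) / N - k / N" by linarith
    also have "\<dots> = 1 / N" by (simp add: diff_divide_distrib[symmetric])
    finally have "v - u < d" using N by linarith
    moreover have False if "u < n" "n < v" for n :: int
    proof -
      \<comment> \<open>Scaling by \<open>N\<close> would put the integer \<open>n * N\<close>
        strictly between consecutive integers.\<close>
      have "k < n * N" "n * N < k + 1" using that k N
        by (smt (verit) of_int_0_less_iff of_int_add of_int_1 of_int_less_iff of_int_mult pos_divide_le_eq pos_le_divide_eq)+
      then show False by linarith
    qed
    ultimately show "v - u < d \<and> (\<forall>n::int. \<not> (u < n \<and> n < v))" by blast
  qed
qed

section \<open>The contribution of the integral part\<close>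

lemma finite_ints_between: "finite {n::int. a < real_of_int n \<and> real_of_int n \<le> t}"
proof (rule finite_subset)
  show "{n::int. a < real_of_int n \<and> real_of_int n \<le> t} \<subseteq> {\<lfloor>a\<rfloor>..\<lfloor>t\<rfloor>}"
    by (auto simp: le_floor_iff floor_le_iff)
qed simp

text \<open>On such a cell the floor can jump only at \<open>v\<close>, and then by 1. The bound is
  stated as a multiple of the increment of the floor so that it telescopes too: the total error does
  not grow with the number of cells.\<close>

lemma floor_sum_cell:
  fixes f :: "real \<Rightarrow> real" and a u x v e :: real
  assumes x: "a \<le> u" "u \<le> x" "x \<le> v"
    and no_int: "\<And>n::int. \<not> (u < n \<and> n < v)"
    and close: "u < v \<Longrightarrow> v \<in> \<int> \<Longrightarrow> \<bar>f u - f v\<bar> \<le> e"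
  shows "\<bar>f u * (\<lfloor>x\<rfloor> - \<lfloor>u\<rfloor>) + f v * (\<lfloor>v\<rfloor> - \<lfloor>x\<rfloor>)
    - ((\<Sum>n | a < real_of_int n \<and> n \<le> v. f n) - (\<Sum>n | a < real_of_int n \<and> n \<le> u. f n))\<bar>
    \<le> e * (\<lfloor>v\<rfloor> - \<lfloor>u\<rfloor>)"
proof (cases "u < v \<and> v \<in> \<int>")
  case True
  then obtain m :: int where m: "v = m" by (auto elim: Ints_cases)
  have "real_of_int (m - 1) \<le> u" using no_int[of "m - 1"] m by force
  then have u: "\<lfloor>u\<rfloor> = m - 1" using True m by (intro floor_unique) auto
  \<comment> \<open>Passing from \<open>u\<close> to \<open>v\<close> thus adds the single term
    \<open>f v\<close> to the sum over integers.\<close>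
  have "real_of_int n \<le> v \<longleftrightarrow> n = m \<or> n \<le> u" for n
    using no_int[of n] True m of_int_eq_iff[of n m, where 'a = real] by linarith
  moreover have "a < m" using True x m by simp
  ultimately have "{n::int. a < n \<and> n \<le> v} = insert m {n. a < n \<and> n \<le> u}" by auto
  then have F: "(\<Sum>n | a < real_of_int n \<and> n \<le> v. f n) =
      f v + (\<Sum>n | a < real_of_int n \<and> n \<le> u. f n)"
    using True m by (simp add: finite_ints_between)
  show ?thesis
  proof (cases "x = v")
    case True
    then show ?thesis using close u m \<open>u < v \<and> v \<in> \<int>\<close> F by simp
  next
    case False
    then have "\<lfloor>x\<rfloor> = m - 1" using x u m \<open>real_of_int (m - 1) \<le> u\<close> by (intro floor_unique) auto
    \<comment> \<open>For a tag below \<open>v\<close> the error is 0; \<open>e\<close> is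
      nonnegative because it bounds an absolute value.\<close>
    then show ?thesis using close u m \<open>u < v \<and> v \<in> \<int>\<close> F abs_ge_zero[of "f u - f v"]
      by (simp del: abs_ge_zero)
  qed
next
  case False
  \<comment> \<open>Either the cell is a point or \<open>v\<close> is not an integer. In both cases
    the floor is constant on the cell, and the two expressions compared vanish.\<close>
  have v: "of_int \<lfloor>v\<rfloor> \<le> u"
  proof (cases "u = v")
    case uv: False
    then have "v \<notin> \<int>" using False x by auto
    then have "of_int \<lfloor>v\<rfloor> \<noteq> v" by (metis Ints_of_int)
    then have "of_int \<lfloor>v\<rfloor> < v" using of_int_floor_le[of v] by linarith
    then show ?thesis using no_int[of "\<lfloor>v\<rfloor>"] by linarith
  qed simp
  have "\<lfloor>v\<rfloor> \<le> \<lfloor>u\<rfloor>" using v by (simp add: le_floor_iff)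
  moreover have "\<lfloor>u\<rfloor> \<le> \<lfloor>x\<rfloor>" "\<lfloor>x\<rfloor> \<le> \<lfloor>v\<rfloor>" using x by (auto intro: floor_mono)
  ultimately have fl: "\<lfloor>x\<rfloor> = \<lfloor>v\<rfloor>" "\<lfloor>u\<rfloor> = \<lfloor>v\<rfloor>" by linarith+
  have "real_of_int n \<le> v \<longleftrightarrow> real_of_int n \<le> u" for n
    using fl by (simp add: le_floor_iff[symmetric])
  then show ?thesis by (simp add: fl)
qed

text \<open>The partial sums \<open>F\<close> over the integers up to \<open>t\<close> vanish at
  \<open>a\<close>, so the full sum is the sum of the increments of \<open>F\<close>, to be compared
  cell by cell.\<close>

lemma floor_sum_bound:
  fixes f :: "real \<Rightarrow> real" and a b e :: real
  assumes ab: "a \<le> b" and p: "p tagged_division_of {a..b}"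
    and no_int: "\<And>x K n. (x, K) \<in> p \<Longrightarrow> \<not> (Inf K < real_of_int n \<and> real_of_int n < Sup K)"
    and close: "\<And>x K. (x, K) \<in> p \<Longrightarrow> Inf K < Sup K \<Longrightarrow> Sup K \<in> \<int> \<Longrightarrow>
      \<bar>f (Inf K) - f (Sup K)\<bar> \<le> e"
  shows "\<bar>(\<Sum>(x, K)\<in>p. f (Inf K) * (\<lfloor>x\<rfloor> - \<lfloor>Inf K\<rfloor>) + f (Sup K) * (\<lfloor>Sup K\<rfloor> - \<lfloor>x\<rfloor>))
    - (\<Sum>n | a < real_of_int n \<and> n \<le> b. f n)\<bar> \<le> e * (\<lfloor>b\<rfloor> - \<lfloor>a\<rfloor>)"
proof -
  define F :: "real \<Rightarrow> real" where "F = (\<lambda>t. \<Sum>n | a < real_of_int n \<and> n \<le> t. f n)"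
  let ?c = "\<lambda>(x, K). f (Inf K) * (\<lfloor>x\<rfloor> - \<lfloor>Inf K\<rfloor>) + f (Sup K) * (\<lfloor>Sup K\<rfloor> - \<lfloor>x\<rfloor>)"
  have "F a = 0" unfolding F_def by (rule sum.neutral) auto
  then have F: "F b = (\<Sum>(x, K)\<in>p. F (Sup K) - F (Inf K))"
    using additive_tagged_division_1[OF ab p, of F] by simp
  have e: "e * (\<lfloor>b\<rfloor> - \<lfloor>a\<rfloor>) = (\<Sum>(x, K)\<in>p. e * (\<lfloor>Sup K\<rfloor> - \<lfloor>Inf K\<rfloor>))"
    using additive_tagged_division_1[OF ab p, of "\<lambda>t. e * \<lfloor>t\<rfloor>"] by (simp add: algebra_simps)
  have "\<bar>sum ?c p - F b\<bar> = \<bar>\<Sum>s\<in>p. ?c s - (case s of (x, K) \<Rightarrow> F (Sup K) - F (Inf K))\<bar>"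
    unfolding F by (simp only: sum_subtractf)
  also have "\<dots> \<le> (\<Sum>(x, K)\<in>p. e * (\<lfloor>Sup K\<rfloor> - \<lfloor>Inf K\<rfloor>))"
  proof (rule order_trans[OF sum_abs sum_mono])
    fix s assume s: "s \<in> p"
    obtain x K where xK: "s = (x, K)" by (rule prod.exhaust)
    obtain u v where K: "K = {u..v}" "a \<le> u" "u \<le> x" "x \<le> v"
      using tagged_division_of_real_cell[OF p] s xK by metis
    have K': "Inf K = u" "Sup K = v" using K by auto
    show "\<bar>?c s - (case s of (x, K) \<Rightarrow> F (Sup K) - F (Inf K))\<bar>
        \<le> (case s of (x, K) \<Rightarrow> e * (\<lfloor>Sup K\<rfloor> - \<lfloor>Inf K\<rfloor>))"
      using floor_sum_cell[OF K(2-4), of f e] no_int close s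
      unfolding xK prod.case F_def K' by (metis K')
  qed
  finally show ?thesis unfolding F_def e .
qed

text \<open>Only finitely many integers are involved, so the conditions that hold for all small
  \<open>d\<close> at each of them hold simultaneously.\<close>

lemma left_continuous_at_ints_uniform:
  fixes f :: "real \<Rightarrow> real" and a b e :: real
  assumes cont: "\<And>n::int. a < real_of_int n \<Longrightarrow> real_of_int n \<le> b \<Longrightarrow>
      continuous (at_left (real_of_int n)) f" and e: "0 < e"
  obtains d :: real where "0 < d" "\<And>n u. a < real_of_int n \<Longrightarrow> real_of_int n \<le> b \<Longrightarrow>
    n - d < u \<Longrightarrow> u < real_of_int n \<Longrightarrow> \<bar>f u - f n\<bar> < e"
proof -
  let ?P = "\<lambda>n d. \<forall>u. real_of_int n - d < u \<longrightarrow> u < real_of_int n \<longrightarrow> \<bar>f u - f n\<bar> < e"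
  have "\<forall>\<^sub>F d in at_right 0. ?P n d" if n: "a < real_of_int n" "real_of_int n \<le> b" for n
  proof -
    have "(f \<longlongrightarrow> f n) (at_left (real_of_int n))" using cont[OF n] by (simp add: continuous_within)
    then have "\<forall>\<^sub>F u in at_left (real_of_int n). \<bar>f u - f n\<bar> < e"
      using e by (simp add: tendsto_iff dist_real_def)
    then obtain c where "c < real_of_int n" "\<And>u. c < u \<Longrightarrow> u < real_of_int n \<Longrightarrow> \<bar>f u - f n\<bar> < e"
      unfolding eventually_at_left_field by blast
    then show ?thesis unfolding eventually_at_right_field
      by (intro exI[of _ "n - c"]) auto
  qed
  then have "\<forall>\<^sub>F d in at_right 0. \<forall>n\<in>{n. a < real_of_int n \<and> real_of_int n \<le> b}. ?P n d"
    by (intro eventually_ball_finite finite_ints_between) auto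
  then obtain c where c: "0 < c" "\<And>d n. 0 < d \<Longrightarrow> d < c \<Longrightarrow>
      a < real_of_int n \<Longrightarrow> real_of_int n \<le> b \<Longrightarrow> ?P n d"
    unfolding eventually_at_right_field by blast
  show thesis
  proof (rule that)
    show "0 < c / 2" using c(1) by simp
  next
    fix n u assume "a < real_of_int n" "real_of_int n \<le> b" "n - c / 2 < u" "u < real_of_int n"
    then show "\<bar>f u - f n\<bar> < e" using c(2)[of "c / 2" n] c(1) by simp
  qed
qed

section \<open>The Stieltjes integral of the sawtooth function\<close>

text \<open>The value is the claimed identity solved for the Stieltjes integral, so existence and
  value are obtained together.\<close>

lemma has_rs_integral_sawtooth:
  fixes f :: "real \<Rightarrow> real" and a b :: real
  assumes ab: "a \<le> b" and I: "has_riemann_integral f I a b"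
    and cont: "\<And>n::int. a < real_of_int n \<Longrightarrow> real_of_int n \<le> b \<Longrightarrow>
      continuous (at_left (real_of_int n)) f"
  shows "has_rs_integral (\<lambda>u. u - of_int \<lfloor>u\<rfloor> - 1/2) f
    ((\<Sum>n | a < real_of_int n \<and> n \<le> b. f n) - I
      + f b * (b - \<lfloor>b\<rfloor> - 1/2) - f a * (a - \<lfloor>a\<rfloor> - 1/2)) a b"
proof -
  define g where "g = (\<lambda>u. u - real_of_int \<lfloor>u\<rfloor> - 1/2)"
  let ?J = "(\<Sum>n | a < real_of_int n \<and> n \<le> b. f n) - I + f b * g b - f a * g a"
  have "\<exists>D. D division_of {a..b} \<and>
      (\<forall>p. p tagged_division_of {a..b} \<and> (\<forall>(x, K)\<in>p. \<exists>K'\<in>D. K \<subseteq> K') \<longrightarrow>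
        \<bar>(\<Sum>(x, K)\<in>p. g x * (f (Sup K) - f (Inf K))) - ?J\<bar> < e)" if e: "e > 0" for e
  proof -
    \<comment> \<open>This counts the integers in the sum, each of which costs at most
      \<open>e'\<close>. Dividing by \<open>N + 1\<close> covers the case of no integers.\<close>
    define N where "N = real_of_int (\<lfloor>b\<rfloor> - \<lfloor>a\<rfloor>)"
    have N: "0 \<le> N" using ab by (simp add: N_def floor_mono)
    define e' where "e' = e / (2 * (N + 1))"
    have e': "0 < e'" "e' * N \<le> e / 2" using e N by (simp_all add: e'_def field_simps)
    obtain d1 where d1: "d1 > 0" and riemann: "\<And>p. p tagged_division_of {a..b} \<Longrightarrow>
        (\<forall>(x, K)\<in>p. content K < d1) \<Longrightarrow> \<bar>(\<Sum>(x, K)\<in>p. content K * f x) - I\<bar> < e / 2"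
      using I e unfolding has_riemann_integral_def by (meson half_gt_zero)
    obtain d2 :: real where d2: "d2 > 0"
      and left: "\<And>n u. a < real_of_int n \<Longrightarrow> real_of_int n \<le> b \<Longrightarrow>
        n - d2 < u \<Longrightarrow> u < real_of_int n \<Longrightarrow> \<bar>f u - f n\<bar> < e'"
      using left_continuous_at_ints_uniform[of a b f, OF cont e'(1)] by metis
    \<comment> \<open>Below \<open>d1\<close> the Riemann sums are controlled, below
      \<open>d2\<close> the jumps of the floor.\<close>
    obtain D where D: "D division_of {a..b}"
      and fine: "\<And>u v K'. u \<le> v \<Longrightarrow> {u..v} \<subseteq> K' \<Longrightarrow> K' \<in> D \<Longrightarrow>
        v - u < min d1 d2 \<and> (\<forall>n::int. \<not> (u < n \<and> n < v))"
      using fine_division_at_integers[OF ab, of "min d1 d2"] d1 d2 by (metis min_less_iff_conj)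
    have "\<bar>(\<Sum>(x, K)\<in>p. g x * (f (Sup K) - f (Inf K))) - ?J\<bar> < e"
      if p: "p tagged_division_of {a..b}" and ref: "\<forall>(x, K)\<in>p. \<exists>K'\<in>D. K \<subseteq> K'" for p
    proof -
      have cell: "v - u < d1" "v - u < d2" "\<And>n::int. \<not> (u < n \<and> n < v)"
        if "(x, {u..v}) \<in> p" "u \<le> v" for x u v
        using ref that fine[of u v] by fastforce+
      define R where "R = (\<Sum>(x, K)\<in>p. f (Inf K) * (x - Inf K) + f (Sup K) * (Sup K - x))"
      define S where "S = (\<Sum>(x, K)\<in>p.
        f (Inf K) * (\<lfloor>x\<rfloor> - \<lfloor>Inf K\<rfloor>) + f (Sup K) * (\<lfloor>Sup K\<rfloor> - \<lfloor>x\<rfloor>))"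
      \<comment> \<open>Increments of \<open>g\<close> are those of the identity minus those of the
        floor; the constant 1/2 cancels.\<close>
      have "(\<Sum>(x, K)\<in>p. f (Inf K) * (g x - g (Inf K)) + f (Sup K) * (g (Sup K) - g x)) = R - S"
        unfolding R_def S_def sum_subtractf[symmetric]
        by (intro sum.cong) (auto simp: g_def algebra_simps)
      then have sum: "(\<Sum>(x, K)\<in>p. g x * (f (Sup K) - f (Inf K))) = f b * g b - f a * g a - R + S"
        using rs_sum_by_parts[OF ab p, of g f] by simp
      \<comment> \<open>\<open>R\<close> is a Riemann sum over the halves, which are no longer than
        their cells.\<close>
      have "content L < d1" if yL: "(y, L) \<in> split_at_tags p" for y L
      proof -
        obtain x u v where c: "(x, {u..v}) \<in> p" "u \<le> x" "x \<le> v"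
          "y = u \<and> L = {u..x} \<or> y = v \<and> L = {x..v}"
          using split_at_tags_cases[OF p yL] by metis
        then show ?thesis using cell(1)[OF c(1)] by auto
      qed
      then have R: "\<bar>R - I\<bar> < e / 2"
        using riemann[OF split_at_tags_tagged_division[OF p]] sum_split_at_tags[OF p, of f]
        unfolding R_def by auto
      have "\<bar>S - (\<Sum>n | a < real_of_int n \<and> n \<le> b. f n)\<bar> \<le> e' * N"
        unfolding S_def N_def
      proof (rule floor_sum_bound[OF ab p])
        fix x K assume xK: "(x, K) \<in> p"
        obtain u v where K: "K = {u..v}" "a \<le> u" "u \<le> x" "x \<le> v" "v \<le> b"
          using tagged_division_of_real_cell[OF p xK] .
        show "\<not> (Inf K < real_of_int n \<and> real_of_int n < Sup K)" for n
          using cell(3) xK K by auto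
        show "\<bar>f (Inf K) - f (Sup K)\<bar> \<le> e'" if "Inf K < Sup K" "Sup K \<in> \<int>"
        proof -
          obtain n :: int where n: "v = n" using \<open>Sup K \<in> \<int>\<close> K by (auto elim: Ints_cases)
          \<comment> \<open>Left continuity applies at \<open>n\<close> since
            \<open>a \<le> u < n\<close>, which keeps the integer \<open>n\<close> to the right of
            \<open>a\<close>.\<close>
          show ?thesis using left[of n u] cell(2)[of x u v] xK K that n by force
        qed
      qed
      then show ?thesis using R e'(2) unfolding sum by linarith
    qed
    then show ?thesis using D by blast
  qed
  then have "has_rs_integral g f ?J a b" unfolding has_rs_integral_def by blast
  then show ?thesis unfolding g_def .
qed

theorem corollary1:
  fixes f :: "real \<Rightarrow> real" and a b :: real
  assumes "a \<le> b"
    and "riemann_integrable f a b"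
    and "\<And>n::int. a < real_of_int n \<Longrightarrow> real_of_int n \<le> b \<Longrightarrow>
           continuous (at_left (real_of_int n)) f"
  shows "rs_integrable (\<lambda>u. u - real_of_int \<lfloor>u\<rfloor> - 1/2) f a b \<and>
    (\<Sum>n\<in>{n::int. a < real_of_int n \<and> real_of_int n \<le> b}. f (real_of_int n)) =
      integral {a..b} f
      + rs_integral (\<lambda>u. u - real_of_int \<lfloor>u\<rfloor> - 1/2) f a b
      + f a * (a - real_of_int \<lfloor>a\<rfloor> - 1/2)
      - f b * (b - real_of_int \<lfloor>b\<rfloor> - 1/2)"
proof -
  obtain I where I: "has_riemann_integral f I a b"
    using assms(2) unfolding riemann_integrable_def by blast
  have int: "integral {a..b} f = I"
    using has_riemann_integral_imp_has_integral[OF I] by (rule integral_unique)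
  \<comment> \<open>This gives integrability directly; by uniqueness the description
    \<open>rs_integral\<close> denotes this value, and the identity is a rearrangement.\<close>
  note rs = has_rs_integral_sawtooth[OF assms(1) I assms(3)]
  show ?thesis
    using rs has_rs_integral_imp_eq[OF rs] int unfolding rs_integrable_def by auto
qed

end
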